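(* Let $n\ge 3$, and let $\vec{x}_1(t),\dots,\vec{x}_n(t)\in\mathbb{R}^2$ be differentiable functions of $t$ in an interval, with $\vec{x}_{i+1}(t)\neq\vec{x}_i(t)$ for $1\le i\le n$ (indices modulo $n$). Suppose that for every $t$ the velocity vector $\dot X=(\dot{\vec{x}}_1^\top,\dots,\dot{\vec{x}}_n^\top)^\top\in\mathbb{R}^{2n}$ is the solution of the linear system $A\dot X=G$, where $A=A(\vec{x}_1,\dots,\vec{x}_n)$ and $G=G(\vec{x}_1,\dots,\vec{x}_n)$ are the discrete mean curvature flow matrix and right-hand side defined in the context (equivalently, $\frac{\partial\Phi_h}{\partial\dot{\vec{x}}_i}+\frac{\partial\mathcal{E}_h}{\partial\vec{x}_i}=0$ for $1\le i\le n$). Then $$\frac{\mathrm{d}\mathcal{E}_h}{\mathrm{d}t}=-2\Phi_h\le 0,$$ and the equality $\frac{\mathrm{d}\mathcal{E}_h}{\mathrm{d}t}=0$ holds if and only if $\dot{\vec{x}}_i=0$ for all $1\le i\le n$.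
   Context: Indices are cyclic: $\vec{x}_{n+1}=\vec{x}_1$, $\vec{x}_0=\vec{x}_n$. The closed polygonal curve is $\Gamma_h(t)=\bigcup_{i=1}^n\Gamma_i(t)$, where $\Gamma_i(t)$ is the segment from $\vec{x}_i(t)$ to $\vec{x}_{i+1}(t)$. A dot denotes the time derivative. Discrete energy: $\mathcal{E}_h=\sum_{i=1}^n|\vec{x}_{i+1}-\vec{x}_i|$ (the length of $\Gamma_h$). Discrete velocity: at the point $(1-\mu)\vec{x}_i+\mu\vec{x}_{i+1}$ of $\Gamma_i$, $\mu\in[0,1]$, set $\vec{v}_h=(1-\mu)\dot{\vec{x}}_i+\mu\dot{\vec{x}}_{i+1}$. Discrete dissipation function: $\Phi_h=\frac12\int_{\Gamma_h}|\vec{v}_h|^2\,\mathrm{d}s=\frac12\sum_{i=1}^n|\vec{x}_{i+1}-\vec{x}_i|\int_0^1|(1-\mu)\dot{\vec{x}}_i+\mu\dot{\vec{x}}_{i+1}|^2\,\mathrm{d}\mu$, where $s$ is arc length; it is a quadratic form in $\dot X$ with coefficients depending on $(\vec{x}_i)$. $A$ is the symmetric $2n\times2n$ matrix with $\Phi_h=\frac12\dot X^\top A\dot X$; in $2\times2$ blocks, $A_{ii}=\frac{|\vec{x}_i-\vec{x}_{i-1}|+|\vec{x}_{i+1}-\vec{x}_i|}{3}I_2$, $A_{i,i+1}=A_{i+1,i}=\frac{|\vec{x}_{i+1}-\vec{x}_i|}{6}I_2$ (indices cyclic), and all other blocks are zero. $G=(\vec{g}_1^\top,\dots,\vec{g}_n^\top)^\top$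 with $\vec{g}_i=-\frac{\partial\mathcal{E}_h}{\partial\vec{x}_i}=\frac{\vec{x}_{i+1}-\vec{x}_i}{|\vec{x}_{i+1}-\vec{x}_i|}-\frac{\vec{x}_i-\vec{x}_{i-1}}{|\vec{x}_i-\vec{x}_{i-1}|}$. *)

theory Defs
  imports "HOL-Analysis.Analysis" "Jordan_Normal_Form.Matrix"
begin

text \<open>
  A closed polygon with \<open>n\<close> vertices is a function \<open>x :: nat \<Rightarrow> real^2\<close>, of which only the values at
  \<open>0, \<dots>, n - 1\<close> matter (so vertex \<open>i\<close> of the usual numbering \<open>1, \<dots>, n\<close> is \<open>x (i - 1)\<close>). Vertex
  velocities \<open>v\<close> are encoded in the same way.
\<close>

definition nxt :: "nat \<Rightarrow> nat \<Rightarrow> nat" where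
  "nxt n i = Suc i mod n"

definition prv :: "nat \<Rightarrow> nat \<Rightarrow> nat" where
  "prv n i = (i + n - 1) mod n"

definition energy :: "nat \<Rightarrow> (nat \<Rightarrow> real^2) \<Rightarrow> real" where
  "energy n x = (\<Sum>i<n. norm (x (nxt n i) - x i))"

definition dissipation :: "nat \<Rightarrow> (nat \<Rightarrow> real^2) \<Rightarrow> (nat \<Rightarrow> real^2) \<Rightarrow> real" where
  "dissipation n x v = 1/2 * (\<Sum>i<n. norm (x (nxt n i) - x i) *
     integral {0..1} (\<lambda>\<mu>. (norm ((1 - \<mu>) *\<^sub>R v i + \<mu> *\<^sub>R v (nxt n i)))\<^sup>2))"

text \<open>
  Every \<open>2 \<times> 2\<close> block of the matrix of the flow is a multiple of the identity; \<open>block_coeff n x i j\<close>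
  is the scalar factor of block \<open>(i, j)\<close>. For \<open>n \<ge> 3\<close> the cases do not overlap.
\<close>

definition block_coeff :: "nat \<Rightarrow> (nat \<Rightarrow> real^2) \<Rightarrow> nat \<Rightarrow> nat \<Rightarrow> real" where
  "block_coeff n x i j =
     (if j = i then (norm (x i - x (prv n i)) + norm (x (nxt n i) - x i)) / 3
      else if j = nxt n i then norm (x (nxt n i) - x i) / 6
      else if i = nxt n j then norm (x (nxt n j) - x j) / 6
      else 0)"

text \<open>
  Rows and columns are numbered from \<open>0\<close>: index \<open>2 * i + c\<close> with \<open>c < 2\<close> is coordinate \<open>c + 1\<close> of
  vertex \<open>i\<close>.
\<close>

definition flow_matrix :: "nat \<Rightarrow> (nat \<Rightarrow> real^2) \<Rightarrow> real Matrix.mat" where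
  "flow_matrix n x = Matrix.mat (2 * n) (2 * n)
     (\<lambda>(k, l). if k mod 2 = l mod 2 then block_coeff n x (k div 2) (l div 2) else 0)"

definition stack :: "nat \<Rightarrow> (nat \<Rightarrow> real^2) \<Rightarrow> real Matrix.vec" where
  "stack n v = Matrix.vec (2 * n)
     (\<lambda>k. if even k then vec_nth (v (k div 2)) 1 else vec_nth (v (k div 2)) 2)"

definition force :: "nat \<Rightarrow> (nat \<Rightarrow> real^2) \<Rightarrow> nat \<Rightarrow> real^2" where
  "force n x i = (x (nxt n i) - x i) /\<^sub>R norm (x (nxt n i) - x i)
               - (x i - x (prv n i)) /\<^sub>R norm (x i - x (prv n i))"

definition flow_system :: "nat \<Rightarrow> (nat \<Rightarrow> real^2) \<Rightarrow> (nat \<Rightarrow> real^2) \<Rightarrow> bool" where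
  "flow_system n x v \<longleftrightarrow> flow_matrix n x *\<^sub>v stack n v = stack n (force n x)"

text \<open>
  The variational form: the partial gradients of the dissipation with respect to the velocity of
  vertex \<open>i\<close> and of the energy with respect to its position exist and add up to zero.
\<close>

definition onsager_system :: "nat \<Rightarrow> (nat \<Rightarrow> real^2) \<Rightarrow> (nat \<Rightarrow> real^2) \<Rightarrow> bool" where
  "onsager_system n x v \<longleftrightarrow> (\<forall>i<n. \<exists>p q.
     GDERIV (\<lambda>y. dissipation n x (v(i := y))) (v i) :> p \<and>
     GDERIV (\<lambda>y. energy n (x(i := y))) (x i) :> q \<and>
     p + q = 0)"

end

theory Submission imports Defs begin

text \<open>
  The dissipation is half the quadratic form of the flow matrix, so the gradient of the dissipation
  in the velocities is \<open>A v\<close>, and a cyclic summation by parts shows that the differential of the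
  energy is \<open>- \<Sum>\<^sub>i force\<^sub>i \<bullet> x'\<^sub>i\<close>. Pairing \<open>A v = G\<close> with \<open>v\<close> gives \<open>dE/dt = - 2 \<Phi>\<close>.
  Since \<open>\<bar>a\<bar>\<^sup>2 + a \<bullet> b + \<bar>b\<bar>\<^sup>2 \<ge> (\<bar>a\<bar>\<^sup>2 + \<bar>b\<bar>\<^sup>2) / 2\<close> and all edges have positive length, \<open>\<Phi>\<close>
  vanishes only for \<open>v = 0\<close>.
\<close>

section \<open>Cyclic shifts of the vertex indices\<close>

lemma nxt_eq: "i < n \<Longrightarrow> nxt n i = (if Suc i = n then 0 else Suc i)"
  by (auto simp: nxt_def)

lemma prv_eq: "i < n \<Longrightarrow> prv n i = (if i = 0 then n - 1 else i - 1)"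
  by (cases i) (auto simp: prv_def)

lemma nxt_less: "i < n \<Longrightarrow> nxt n i < n"
  and prv_less: "i < n \<Longrightarrow> prv n i < n"
  and nxt_prv: "i < n \<Longrightarrow> nxt n (prv n i) = i"
  and prv_nxt: "i < n \<Longrightarrow> prv n (nxt n i) = i"
  by (auto simp: nxt_eq prv_eq split: if_splits)

text \<open>The backward shift permutes the vertices, with \<open>nxt n\<close> as its inverse. On a
  closed polygon summation by parts therefore leaves no boundary term.\<close>

lemma sum_prv:
  fixes f :: "nat \<Rightarrow> 'a::comm_monoid_add"
  shows "(\<Sum>i<n. f (prv n i)) = (\<Sum>i<n. f i)"
  by (rule sum.reindex_bij_witness[where i = "nxt n" and j = "prv n"])
    (auto simp: nxt_less prv_less nxt_prv prv_nxt)

section \<open>From scalar coordinates to one vector equation per vertex\<close>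

lemma sum_double:
  fixes f :: "nat \<Rightarrow> 'a::comm_monoid_add"
  shows "(\<Sum>l<2 * n. f l) = (\<Sum>j<n. f (2 * j) + f (Suc (2 * j)))"
  by (induction n) (auto simp: add.assoc)

lemma stack_eq_iff: "stack n v = stack n w \<longleftrightarrow> (\<forall>i<n. v i = w i)"
proof
  assume eq: "stack n v = stack n w"
  show "\<forall>i<n. v i = w i"
  proof (intro allI impI)
    fix i assume i: "i < n"
    have "vec_index (stack n v) (2 * i) = vec_index (stack n w) (2 * i)"
      "vec_index (stack n v) (Suc (2 * i)) = vec_index (stack n w) (Suc (2 * i))"
      using eq by simp_all
    then have "vec_nth (v i) 1 = vec_nth (w i) 1" "vec_nth (v i) 2 = vec_nth (w i) 2"
      using i by (simp_all add: stack_def)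
    then show "v i = w i" by (simp add: Finite_Cartesian_Product.vec_eq_iff forall_2)
  qed
next
  assume "\<forall>i<n. v i = w i"
  then show "stack n v = stack n w"
    by (intro eq_vecI) (auto simp: stack_def)
qed

lemma flow_matrix_mult_stack:
  "flow_matrix n x *\<^sub>v stack n v = stack n (\<lambda>i. \<Sum>j<n. block_coeff n x i j *\<^sub>R v j)"
proof (rule eq_vecI)
  fix k assume "k < dim_vec (stack n (\<lambda>i. \<Sum>j<n. block_coeff n x i j *\<^sub>R v j))"
  then have k: "k < 2 * n" by (simp add: stack_def)
  have "vec_index (flow_matrix n x *\<^sub>v stack n v) k =
    (\<Sum>l<2 * n. (if k mod 2 = l mod 2 then block_coeff n x (k div 2) (l div 2) else 0) *
      (if even l then vec_nth (v (l div 2)) 1 else vec_nth (v (l div 2)) 2))"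
    using k by (simp add: flow_matrix_def stack_def scalar_prod_def lessThan_atLeast0)
  \<comment> \<open>Once the columns are paired, each pair contributes only its column of the same
    parity as \<open>k\<close>: blocks are multiples of the identity, so coordinates do not
    mix.\<close>
  also have "\<dots> = vec_index (stack n (\<lambda>i. \<Sum>j<n. block_coeff n x i j *\<^sub>R v j)) k"
    using k unfolding sum_double
    by (cases "even k") (auto simp: stack_def even_iff_mod_2_eq_zero odd_iff_mod_2_eq_one)
  finally show "vec_index (flow_matrix n x *\<^sub>v stack n v) k = \<dots>" .
qed (simp add: flow_matrix_def stack_def)

lemma flow_system_iff:
  "flow_system n x v \<longleftrightarrow> (\<forall>i<n. (\<Sum>j<n. block_coeff n x i j *\<^sub>R v j) = force n x i)"
  by (simp add: flow_system_def flow_matrix_mult_stack stack_eq_iff)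

section \<open>The bilinear form of the flow matrix\<close>

lemma sum_block_coeff:
  fixes v :: "nat \<Rightarrow> real^2"
  assumes "n \<ge> 3" "i < n"
  shows "(\<Sum>j<n. block_coeff n x i j *\<^sub>R v j) =
    ((norm (x i - x (prv n i)) + norm (x (nxt n i) - x i)) / 3) *\<^sub>R v i
    + (norm (x (nxt n i) - x i) / 6) *\<^sub>R v (nxt n i)
    + (norm (x i - x (prv n i)) / 6) *\<^sub>R v (prv n i)"
proof -
  let ?S = "{i, nxt n i, prv n i}"
  \<comment> \<open>This is where \<open>n \<ge> 3\<close> enters: for two vertices both neighbours
    would coincide.\<close>
  have distinct: "nxt n i \<noteq> i" "prv n i \<noteq> i" "nxt n i \<noteq> prv n i"
    using assms by (auto simp: nxt_eq prv_eq split: if_splits)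
  have "(\<Sum>j<n. block_coeff n x i j *\<^sub>R v j) = (\<Sum>j\<in>?S. block_coeff n x i j *\<^sub>R v j)"
    using assms nxt_less[of i n] prv_less[of i n]
    by (intro sum.mono_neutral_right) (auto simp: block_coeff_def prv_nxt)
  then show ?thesis
    using distinct distinct[symmetric] assms
    by (simp add: block_coeff_def nxt_prv add.assoc)
qed

text \<open>Regroups a sum over vertices by edges; an edge of length l carries the matrix with rows
  (2, 1) and (1, 2), times l/6. The second argument \<open>w\<close> is kept free:
  \<open>w = v\<close> gives the quadratic form, a variation of \<open>v\<close> gives its
  differential.\<close>

lemma sum_inner_block_coeff:
  fixes v w :: "nat \<Rightarrow> real^2"
  assumes "n \<ge> 3"
  shows "(\<Sum>i<n. inner (\<Sum>j<n. block_coeff n x i j *\<^sub>R v j) (w i)) =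
    (\<Sum>i<n. norm (x (nxt n i) - x i) / 6 *
      (2 * inner (v i) (w i) + inner (v i) (w (nxt n i))
       + inner (v (nxt n i)) (w i) + 2 * inner (v (nxt n i)) (w (nxt n i))))"
proof -
  define l where "l i = norm (x (nxt n i) - x i)" for i
  \<comment> \<open>The share of edge \<open>i\<close> in the row of its end vertex
    \<open>nxt n i\<close>; row \<open>i\<close> thus receives \<open>a (prv n i)\<close>, and
    \<open>sum_prv\<close> moves it back to its edge.\<close>
  define a where "a i = l i / 3 * inner (v (nxt n i)) (w (nxt n i))
    + l i / 6 * inner (v i) (w (nxt n i))" for i
  have "inner (\<Sum>j<n. block_coeff n x i j *\<^sub>R v j) (w i) =
      a (prv n i) + l i / 3 * inner (v i) (w i) + l i / 6 * inner (v (nxt n i)) (w i)"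
    if "i < n" for i
    using assms that
    by (simp add: sum_block_coeff nxt_prv a_def l_def inner_add_left algebra_simps add_divide_distrib)
  then have "(\<Sum>i<n. inner (\<Sum>j<n. block_coeff n x i j *\<^sub>R v j) (w i)) =
      (\<Sum>i<n. a (prv n i)) + (\<Sum>i<n. l i / 3 * inner (v i) (w i) + l i / 6 * inner (v (nxt n i)) (w i))"
    by (simp add: sum.distrib)
  also have "\<dots> = (\<Sum>i<n. l i / 6 *
      (2 * inner (v i) (w i) + inner (v i) (w (nxt n i))
       + inner (v (nxt n i)) (w i) + 2 * inner (v (nxt n i)) (w (nxt n i))))"
    unfolding sum_prv sum.distrib[symmetric]
    by (rule sum.cong) (simp_all add: a_def algebra_simps)
  finally show ?thesis by (simp add: l_def)
qed

section \<open>Closed form and positivity of the dissipation\<close>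

lemma integral_norm_affine_sq:
  fixes a b :: "'a::real_inner"
  shows "integral {0..1} (\<lambda>\<mu>. (norm ((1 - \<mu>) *\<^sub>R a + \<mu> *\<^sub>R b))\<^sup>2) =
    (inner a a + inner a b + inner b b) / 3"
proof -
  \<comment> \<open>Antiderivative of the integrand expanded around \<open>a\<close> in powers of
    \<open>\<mu>\<close>; the last bracket is the squared norm of \<open>b - a\<close>.\<close>
  define F where "F \<mu> = \<mu> * inner a a + \<mu>\<^sup>2 * (inner a b - inner a a)
    + \<mu>^3 / 3 * (inner a a - 2 * inner a b + inner b b)" for \<mu>
  have "((\<lambda>\<mu>. (norm ((1 - \<mu>) *\<^sub>R a + \<mu> *\<^sub>R b))\<^sup>2) has_integral F 1 - F 0) {0..1}"
  proof (rule fundamental_theorem_of_calculus)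
    fix \<mu> :: real
    have "(norm ((1 - \<mu>) *\<^sub>R a + \<mu> *\<^sub>R b))\<^sup>2 =
        (1 - \<mu>)\<^sup>2 * inner a a + 2 * \<mu> * (1 - \<mu>) * inner a b + \<mu>\<^sup>2 * inner b b"
      unfolding power2_norm_eq_inner
      by (simp add: inner_add_left inner_add_right inner_commute power2_eq_square)
    then show "(F has_vector_derivative (norm ((1 - \<mu>) *\<^sub>R a + \<mu> *\<^sub>R b))\<^sup>2) (at \<mu> within {0..1})"
      unfolding F_def has_real_derivative_iff_has_vector_derivative[symmetric]
      by (auto intro!: derivative_eq_intros simp: power2_eq_square field_simps)
  qed simp
  then have "integral {0..1} (\<lambda>\<mu>. (norm ((1 - \<mu>) *\<^sub>R a + \<mu> *\<^sub>R b))\<^sup>2) = F 1 - F 0"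
    by (rule integral_unique)
  then show ?thesis by (simp add: F_def field_simps)
qed

lemma dissipation_eq:
  "dissipation n x v = (\<Sum>i<n. norm (x (nxt n i) - x i) / 6 *
    (inner (v i) (v i) + inner (v i) (v (nxt n i)) + inner (v (nxt n i)) (v (nxt n i))))"
  by (simp add: dissipation_def integral_norm_affine_sq sum_distrib_left)

lemma two_dissipation:
  assumes "n \<ge> 3"
  shows "2 * dissipation n x v = (\<Sum>i<n. inner (\<Sum>j<n. block_coeff n x i j *\<^sub>R v j) (v i))"
  unfolding sum_inner_block_coeff[OF assms] dissipation_eq sum_distrib_left
  by (rule sum.cong) (simp_all add: inner_commute algebra_simps)

lemma dissipation_ge:
  "dissipation n x v \<ge> (\<Sum>i<n. norm (x (nxt n i) - x i) / 12 * (norm (v i))\<^sup>2)"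
  unfolding dissipation_eq
proof (rule sum_mono)
  fix i
  \<comment> \<open>With a, b the velocities at the two ends, half of this expression is (a
    \<bullet> a + a \<bullet> b + b \<bullet> b) - (a \<bullet> a) / 2. Keeping only the start
    vertex suffices, as every vertex starts exactly one edge.\<close>
  have "0 \<le> inner (v i + v (nxt n i)) (v i + v (nxt n i)) + inner (v (nxt n i)) (v (nxt n i))"
    by simp
  then have "(norm (v i))\<^sup>2 / 2 \<le>
      inner (v i) (v i) + inner (v i) (v (nxt n i)) + inner (v (nxt n i)) (v (nxt n i))"
    by (simp add: power2_norm_eq_inner inner_add_left inner_add_right inner_commute)
  then have "norm (x (nxt n i) - x i) / 6 * ((norm (v i))\<^sup>2 / 2) \<le> norm (x (nxt n i) - x i) / 6 *
      (inner (v i) (v i) + inner (v i) (v (nxt n i)) + inner (v (nxt n i)) (v (nxt n i)))"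
    by (intro mult_left_mono) auto
  then show "norm (x (nxt n i) - x i) / 12 * (norm (v i))\<^sup>2 \<le> norm (x (nxt n i) - x i) / 6 *
      (inner (v i) (v i) + inner (v i) (v (nxt n i)) + inner (v (nxt n i)) (v (nxt n i)))"
    by simp
qed

lemma dissipation_nonneg: "dissipation n x v \<ge> 0"
  by (rule order_trans[OF _ dissipation_ge]) (auto intro: sum_nonneg)

lemma dissipation_eq_0_iff:
  assumes "\<And>i. i < n \<Longrightarrow> x (nxt n i) \<noteq> x i"
  shows "dissipation n x v = 0 \<longleftrightarrow> (\<forall>i<n. v i = 0)"
proof
  assume "dissipation n x v = 0"
  then have "(\<Sum>i<n. norm (x (nxt n i) - x i) / 12 * (norm (v i))\<^sup>2) \<le> 0"
    using dissipation_ge[of x n v] by simp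
  then have "(\<Sum>i<n. norm (x (nxt n i) - x i) / 12 * (norm (v i))\<^sup>2) = 0"
    by (intro antisym sum_nonneg) auto
  \<comment> \<open>All terms are nonnegative, so each vanishes; its weight is positive because the
    edge is nondegenerate.\<close>
  then show "\<forall>i<n. v i = 0"
    using assms by (subst (asm) sum_nonneg_eq_0_iff) auto
qed (auto simp: dissipation_eq nxt_less)

section \<open>Differentials of the dissipation and of the energy\<close>

lemma has_derivative_dissipation:
  assumes "n \<ge> 3" and v: "\<And>i. i < n \<Longrightarrow> ((\<lambda>s. v s i) has_derivative (\<lambda>h. v' h i)) (at s within S)"
  shows "((\<lambda>s. dissipation n x (v s)) has_derivative
    (\<lambda>h. \<Sum>i<n. inner (\<Sum>j<n. block_coeff n x i j *\<^sub>R v s j) (v' h i))) (at s within S)"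
  \<comment> \<open>Differentiating a \<bullet> a + a \<bullet> b + b \<bullet> b on each edge
    yields exactly the edge form above with \<open>w = v' h\<close>.\<close>
  unfolding sum_inner_block_coeff[OF assms(1)] dissipation_eq
  by (rule has_derivative_sum, rule has_derivative_eq_rhs)
    (rule derivative_intros v nxt_less | simp add: inner_commute algebra_simps)+

text \<open>Each vertex ends one edge and starts the next, so it collects the difference of their
  unit tangents. The parameter \<open>s\<close> is general in order to cover both the displacement
  of one vertex and the evolution in time.\<close>

lemma has_derivative_energy:
  assumes x: "\<And>i. i < n \<Longrightarrow> ((\<lambda>s. x s i) has_derivative (\<lambda>h. x' h i)) (at s within S)"
    and "\<And>i. i < n \<Longrightarrow> x s (nxt n i) \<noteq> x s i"
  shows "((\<lambda>s. energy n (x s)) has_derivative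
    (\<lambda>h. - (\<Sum>i<n. inner (force n (x s) i) (x' h i)))) (at s within S)"
proof -
  \<comment> \<open>The unit tangent of edge \<open>i\<close>, which is the gradient of its length
    in the end vertex.\<close>
  define e where "e i = (x s (nxt n i) - x s i) /\<^sub>R norm (x s (nxt n i) - x s i)" for i
  have force: "force n (x s) i = e i - e (prv n i)" if "i < n" for i
    using that by (simp add: force_def e_def nxt_prv)
  have edge: "((\<lambda>s. norm (x s (nxt n i) - x s i)) has_derivative
      (\<lambda>h. inner (e i) (x' h (nxt n i)) - inner (e i) (x' h i))) (at s within S)"
    if i: "i < n" for i
  proof -
    have "((\<lambda>s. x s (nxt n i) - x s i) has_derivative (\<lambda>h. x' h (nxt n i) - x' h i)) (at s within S)"
      using i by (intro has_derivative_diff x nxt_less)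
    \<comment> \<open>The norm is differentiable only away from zero, hence the appeal to distinct
      neighbours.\<close>
    from has_derivative_compose[OF this has_derivative_norm] show ?thesis
      using assms(2)[OF i] unfolding e_def inner_diff_right[symmetric]
      by (simp add: sgn_div_norm inner_commute)
  qed
  have "(\<Sum>i<n. inner (e (prv n i)) (x' h i)) = (\<Sum>i<n. inner (e i) (x' h (nxt n i)))" for h
    using sum_prv[of "\<lambda>i. inner (e i) (x' h (nxt n i))" n] by (simp add: nxt_prv)
  then have "- (\<Sum>i<n. inner (force n (x s) i) (x' h i)) =
      (\<Sum>i<n. inner (e i) (x' h (nxt n i)) - inner (e i) (x' h i))" for h
    by (simp add: force inner_diff_left sum_subtractf)
  then show ?thesis
    unfolding energy_def by (auto intro!: has_derivative_sum edge)
qed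

section \<open>The variational form and the linear system\<close>

lemma has_derivative_fun_upd:
  "((\<lambda>y. (f(i := y)) j) has_derivative (\<lambda>h. if j = i then h else 0)) F"
  by (cases "j = i") auto

lemma sum_inner_unit:
  fixes f :: "nat \<Rightarrow> 'a::real_inner"
  assumes "i < n"
  shows "(\<Sum>j<n. inner (f j) (if j = i then h else 0)) = inner h (f i)"
  using assms by (simp add: if_distrib[of "inner _"] inner_commute cong: if_cong)

text \<open>A variation that moves only the velocity of vertex \<open>i\<close> picks row
  \<open>i\<close> out of the differential.\<close>

lemma GDERIV_dissipation:
  assumes "n \<ge> 3" "i < n"
  shows "GDERIV (\<lambda>y. dissipation n x (v(i := y))) (v i) :> (\<Sum>j<n. block_coeff n x i j *\<^sub>R v j)"
  using has_derivative_dissipation[OF assms(1),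
      where v = "\<lambda>y. v(i := y)" and v' = "\<lambda>h j. if j = i then h else 0" and s = "v i" and x = x]
    has_derivative_fun_upd[of v i]
  by (simp add: gderiv_def sum_inner_unit[OF assms(2)])

lemma GDERIV_energy:
  assumes "i < n" "\<And>i. i < n \<Longrightarrow> x (nxt n i) \<noteq> x i"
  shows "GDERIV (\<lambda>y. energy n (x(i := y))) (x i) :> - force n x i"
  using has_derivative_energy[of n "\<lambda>y. x(i := y)" "\<lambda>h j. if j = i then h else 0" "x i" UNIV]
    has_derivative_fun_upd[of x i] assms(2)
  by (simp add: gderiv_def sum_inner_unit[OF assms(1)])

lemma GDERIV_unique:
  assumes "GDERIV f x :> p" "GDERIV f x :> q"
  shows "p = q"
proof -
  have "(\<lambda>h. inner h p) = (\<lambda>h. inner h q)"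
    using assms unfolding gderiv_def by (rule has_derivative_unique)
  then show ?thesis by (metis vector_eq_ldot)
qed

text \<open>Gradients are unique, so the witnesses \<open>p\<close> and \<open>q\<close> must be row
  \<open>i\<close> of the matrix applied to \<open>v\<close> and \<open>- force n x i\<close>; their
  sum vanishes exactly when that row equation holds.\<close>

lemma onsager_system_iff_flow_system:
  assumes "n \<ge> 3" "\<And>i. i < n \<Longrightarrow> x (nxt n i) \<noteq> x i"
  shows "onsager_system n x v \<longleftrightarrow> flow_system n x v"
proof -
  have "(\<exists>p q. GDERIV (\<lambda>y. dissipation n x (v(i := y))) (v i) :> p \<and>
      GDERIV (\<lambda>y. energy n (x(i := y))) (x i) :> q \<and> p + q = 0) \<longleftrightarrow>
      (\<Sum>j<n. block_coeff n x i j *\<^sub>R v j) = force n x i" if "i < n" for i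
  proof -
    note diss = GDERIV_dissipation[OF assms(1) that, of x v]
    have energy: "GDERIV (\<lambda>y. energy n (x(i := y))) (x i) :> - force n x i"
      using that assms(2) by (rule GDERIV_energy)
    show ?thesis
    proof
      assume "(\<Sum>j<n. block_coeff n x i j *\<^sub>R v j) = force n x i"
      then show "\<exists>p q. GDERIV (\<lambda>y. dissipation n x (v(i := y))) (v i) :> p \<and>
          GDERIV (\<lambda>y. energy n (x(i := y))) (x i) :> q \<and> p + q = 0"
        using diss energy by (intro exI conjI) auto
    qed (use GDERIV_unique[OF diss] GDERIV_unique[OF energy] in force)
  qed
  then show ?thesis by (simp add: onsager_system_def flow_system_iff)
qed

section \<open>Energy decay along the flow\<close>

lemma energy_has_real_derivative:
  assumes "n \<ge> 3"
    and "\<And>i. i < n \<Longrightarrow> (x i has_vector_derivative x' i) (at t within T)"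
    and "\<And>i. i < n \<Longrightarrow> x (nxt n i) t \<noteq> x i t"
    and flow: "flow_system n (\<lambda>i. x i t) x'"
  shows "((\<lambda>t. energy n (\<lambda>i. x i t)) has_real_derivative
    - 2 * dissipation n (\<lambda>i. x i t) x') (at t within T)"
proof -
  have "((\<lambda>t. energy n (\<lambda>i. x i t)) has_derivative
      (\<lambda>h. - (\<Sum>i<n. inner (force n (\<lambda>i. x i t) i) (h *\<^sub>R x' i)))) (at t within T)"
    using assms by (intro has_derivative_energy) (auto simp: has_vector_derivative_def)
  \<comment> \<open>The flow equation replaces the force by the matrix rows, whose pairing with the
    velocities is twice the dissipation.\<close>
  moreover have "- (\<Sum>i<n. inner (force n (\<lambda>i. x i t) i) (h *\<^sub>R x' i)) =
      - 2 * dissipation n (\<lambda>i. x i t) x' * h" for h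
    using two_dissipation[OF assms(1), of "\<lambda>i. x i t" x'] flow
    by (simp add: flow_system_iff sum_distrib_left[symmetric])
  ultimately show ?thesis unfolding has_field_derivative_def by (simp only:)
qed

text \<open>A connected set with more than one point has no isolated points. This makes derivatives
  within \<open>T\<close> unique, also at an endpoint of the interval.\<close>

lemma at_within_interval_neq_bot:
  fixes T :: "real set"
  assumes "is_interval T" "interior T \<noteq> {}" "t \<in> T"
  shows "at t within T \<noteq> bot"
proof -
  have "T \<noteq> {t}" using assms(2) by auto
  then have "t islimpt T"
    using assms by (intro connected_imp_perfect) (auto simp: is_interval_connected)
  then show ?thesis by (simp add: trivial_limit_within)
qed


theorem theorem3p1:
  fixes n :: nat and T :: "real set" and x x' :: "nat \<Rightarrow> real \<Rightarrow> real^2"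
  assumes "n \<ge> 3"
    and "is_interval T" and "interior T \<noteq> {}"
    and "\<And>i t. i < n \<Longrightarrow> t \<in> T \<Longrightarrow> (x i has_vector_derivative x' i t) (at t within T)"
    and "\<And>i t. i < n \<Longrightarrow> t \<in> T \<Longrightarrow> x (nxt n i) t \<noteq> x i t"
  shows "(\<forall>t\<in>T. flow_system n (\<lambda>i. x i t) (\<lambda>i. x' i t) \<longleftrightarrow>
                onsager_system n (\<lambda>i. x i t) (\<lambda>i. x' i t)) \<and>
         ((\<forall>t\<in>T. flow_system n (\<lambda>i. x i t) (\<lambda>i. x' i t)) \<longrightarrow>
          (\<forall>t\<in>T.
             ((\<lambda>t. energy n (\<lambda>i. x i t)) has_real_derivative
                - 2 * dissipation n (\<lambda>i. x i t) (\<lambda>i. x' i t)) (at t within T) \<and>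
             - 2 * dissipation n (\<lambda>i. x i t) (\<lambda>i. x' i t) \<le> 0 \<and>
             (((\<lambda>t. energy n (\<lambda>i. x i t)) has_real_derivative 0) (at t within T) \<longleftrightarrow>
                (\<forall>i<n. x' i t = 0))))"
proof (intro conjI ballI impI)
  fix t assume t: "t \<in> T"
  show "flow_system n (\<lambda>i. x i t) (\<lambda>i. x' i t) \<longleftrightarrow> onsager_system n (\<lambda>i. x i t) (\<lambda>i. x' i t)"
    using assms(1,5) t by (intro onsager_system_iff_flow_system[symmetric])
next
  fix t assume flow: "\<forall>t\<in>T. flow_system n (\<lambda>i. x i t) (\<lambda>i. x' i t)" and t: "t \<in> T"
  let ?E = "\<lambda>t. energy n (\<lambda>i. x i t)" and ?D = "dissipation n (\<lambda>i. x i t) (\<lambda>i. x' i t)"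
  show deriv: "(?E has_real_derivative - 2 * ?D) (at t within T)"
    using assms(1,4,5) flow t by (intro energy_has_real_derivative) auto
  show "- 2 * ?D \<le> 0"
    using dissipation_nonneg[of n "\<lambda>i. x i t" "\<lambda>i. x' i t"] by simp
  \<comment> \<open>By uniqueness a derivative 0 must agree with \<open>- 2 * ?D\<close>.\<close>
  have "(?E has_real_derivative 0) (at t within T) \<longleftrightarrow> ?D = 0"
    using deriv vector_derivative_unique_within[OF at_within_interval_neq_bot[OF assms(2,3) t],
        of ?E "- 2 * ?D" 0]
    by (auto simp: has_real_derivative_iff_has_vector_derivative)
  also have "\<dots> \<longleftrightarrow> (\<forall>i<n. x' i t = 0)"
    using assms(5) t by (intro dissipation_eq_0_iff)
  finally show "(?E has_real_derivative 0) (at t within T) \<longleftrightarrow> (\<forall>i<n. x' i t = 0)" .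
qed

end
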